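(* For every positive integer $n$, the circular permutations in $\mathrm{Av}_n[1324]$ are in one-to-one correspondence with the circled compositions of $n$; in particular $\#\mathrm{Av}_n[1324]$ equals the number of circled compositions of $n$.
   Context: A circular permutation $[\pi]$ of size $n$ is the set of all rotations of a permutation $\pi$ of $[n]$; $[\sigma]$ contains $[\pi]$ if some rotation of $\sigma$ has a subsequence order-isomorphic to $\pi$, otherwise avoids it; $\mathrm{Av}_n[1324]$ is the set of circular permutations of size $n$ avoiding $[1324]$. A circled composition of $n$ is a pair $(a,C)$ where $a=(a_1,\dots,a_k)$ is a composition of $n$ into positive parts and $C\subseteq\{1,\dots,k\}$ satisfies $1\in C$, $k\in C$, and $a_i=1$ for every $i\in C$. *)

theory Defs
  imports "HOL-Combinatorics.Multiset_Permutations" "HOL-Library.Sublist"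
begin

text \<open>A permutation of \<open>[n]\<close> is represented by its one-line notation, that is, by an
  element of \<^term>\<open>permutations_of_set {1..n::nat}\<close>.\<close>

definition circ :: "nat list \<Rightarrow> nat list set" where
  "circ \<pi> = {rotate k \<pi> | k. True}"

definition circular_permutations :: "nat \<Rightarrow> nat list set set" where
  "circular_permutations n = circ ` permutations_of_set {1..n}"

definition order_isomorphic :: "nat list \<Rightarrow> nat list \<Rightarrow> bool" where
  "order_isomorphic xs ys \<longleftrightarrow> length xs = length ys \<and>
     (\<forall>i<length xs. \<forall>j<length xs. xs ! i < xs ! j \<longleftrightarrow> ys ! i < ys ! j)"

definition has_pattern :: "nat list \<Rightarrow> nat list \<Rightarrow> bool" where
  "has_pattern \<sigma> \<pi> \<longleftrightarrow> (\<exists>xs. subseq xs \<sigma> \<and> order_isomorphic xs \<pi>)"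

text \<open>The circular pattern \<open>[\<pi>]\<close> is given by a representative \<open>\<pi>\<close>; the choice is irrelevant by
  \<open>circ_contains_rotate\<close> below.\<close>

definition circ_contains :: "nat list set \<Rightarrow> nat list \<Rightarrow> bool" where
  "circ_contains S \<pi> \<longleftrightarrow> (\<exists>\<tau>\<in>S. has_pattern \<tau> \<pi>)"

definition circ_Av :: "nat \<Rightarrow> nat list \<Rightarrow> nat list set set" where
  "circ_Av n \<pi> = {S \<in> circular_permutations n. \<not> circ_contains S \<pi>}"

text \<open>The part \<open>a\<^sub>i\<close> of the mathematical notation is \<open>a ! (i - 1)\<close>, since lists are indexed
  from \<open>0\<close> whereas the positions in \<open>C\<close> are counted from \<open>1\<close>.\<close>

definition circled_compositions :: "nat \<Rightarrow> (nat list \<times> nat set) set" where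
  "circled_compositions n = {(a, C).
     (\<forall>x\<in>set a. 0 < x) \<and> sum_list a = n \<and>
     C \<subseteq> {1..length a} \<and> 1 \<in> C \<and> length a \<in> C \<and>
     (\<forall>i\<in>C. a ! (i - 1) = 1)}"

lemma circ_rotate_closed: "\<tau> \<in> circ \<sigma> \<Longrightarrow> rotate m \<tau> \<in> circ \<sigma>"
  by (auto simp: circ_def rotate_rotate)

lemma has_pattern_rotate1:
  assumes "has_pattern \<tau> \<pi>"
  shows "\<exists>m. has_pattern (rotate m \<tau>) (rotate1 \<pi>)"
proof (cases \<pi>)
  case Nil
  then show ?thesis using assms by (intro exI[of _ 0]) simp
next
  case (Cons p \<pi>')
  obtain xs where xs: "subseq xs \<tau>" "order_isomorphic xs \<pi>"
    using assms by (auto simp: has_pattern_def)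
  have "length xs = Suc (length \<pi>')"
    using xs(2) unfolding order_isomorphic_def Cons by simp
  then obtain x xs' where x: "xs = x # xs'"
    by (metis length_Suc_conv)
  obtain u v where uv: "\<tau> = u @ x # v" "subseq xs' v"
    using list_emb_ConsD[OF xs(1)[unfolded x]] by blast
  have r: "rotate (length (u @ [x])) \<tau> = v @ (u @ [x])"
    using rotate_append[of "u @ [x]" v] uv(1) by simp
  have "subseq [x] (u @ [x])"
    by (rule list_emb_append2) simp
  then have s: "subseq (xs' @ [x]) (v @ (u @ [x]))"
    using uv(2) by (rule list_emb_append_mono[rotated])
  have len: "length xs' = length \<pi>'"
    using xs(2) unfolding order_isomorphic_def x Cons by simp
  have o: "(x # xs') ! i < (x # xs') ! j \<longleftrightarrow> (p # \<pi>') ! i < (p # \<pi>') ! j"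
    if "i \<le> length xs'" "j \<le> length xs'" for i j
    using xs(2) that unfolding order_isomorphic_def x Cons
    by (metis length_Cons less_Suc_eq_le)
  define g where "g i = (if i < length xs' then Suc i else 0)" for i
  have g: "g i \<le> length xs'" for i
    by (auto simp: g_def)
  have gx: "(xs' @ [x]) ! i = (x # xs') ! g i" "(\<pi>' @ [p]) ! i = (p # \<pi>') ! g i"
    if "i \<le> length xs'" for i
    using that len by (auto simp: g_def nth_append)
  have "order_isomorphic (xs' @ [x]) (\<pi>' @ [p])"
    unfolding order_isomorphic_def using len gx o[OF g g] by (simp add: less_Suc_eq_le)
  then show ?thesis
    using r s Cons unfolding has_pattern_def by (metis rotate1.simps(2))
qed

lemma circ_contains_rotate:
  "circ_contains (circ \<sigma>) (rotate k \<pi>) \<longleftrightarrow> circ_contains (circ \<sigma>) \<pi>"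
proof -
  have step: "circ_contains (circ \<sigma>) \<rho> \<Longrightarrow> circ_contains (circ \<sigma>) (rotate m \<rho>)" for \<rho> m
    by (induction m)
      (simp, metis circ_contains_def circ_rotate_closed has_pattern_rotate1 rotate_Suc)
  have "\<exists>m. rotate m (rotate k \<pi>) = \<pi>"
  proof (cases "\<pi> = []")
    case False
    then have "(length \<pi> - k mod length \<pi>) + k mod length \<pi> = length \<pi>"
      by (simp add: less_imp_le)
    then have "rotate (length \<pi> - k mod length \<pi>) (rotate (k mod length \<pi>) \<pi>) = \<pi>"
      by (simp add: rotate_rotate)
    then show ?thesis by (metis rotate_conv_mod)
  qed simp
  then show ?thesis using step by metis
qed

lemma finite_circ_Av: "finite (circ_Av n \<pi>)"
  by (simp add: circ_Av_def circular_permutations_def)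

lemma finite_circled_compositions: "finite (circled_compositions n)"
proof (rule finite_subset)
  have len: "length a \<le> sum_list a" if "\<forall>x\<in>set a. 0 < x" for a :: "nat list"
    using that by (induction a) auto
  show "circled_compositions n \<subseteq> {a. set a \<subseteq> {..n} \<and> length a \<le> n} \<times> Pow {1..n}"
    using len member_le_sum_list by (fastforce simp: circled_compositions_def)
  show "finite ({a. set a \<subseteq> {..n} \<and> length a \<le> n} \<times> Pow {1..n})"
    using finite_lists_length_le[of "{..n}" n] by simp
qed

end

(* Rotate a circular permutation so that it starts with its minimum. The remaining word has to
   avoid 213 and 4132. Write such a word as A @ l # B with minimum l: avoiding 213 puts every
   entry of A above every entry of B, and if A is nonempty, avoiding 4132 makes B increasing.
   So the word is a singleton, or the minimum followed by a smaller such word, or a smaller such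
   word followed by an increasing run of k >= 1 smaller entries. Recording 0 in the second case
   and k in the third encodes the word by a list of naturals. Reading 0 as a circled part 1 and
   k as an uncircled part k, with a circled 1 added at both ends, gives a circled composition.
   Size 1 is treated apart, since there both end circles coincide. *)
theory Submission
  imports Defs
begin

section \<open>Words avoiding 213 and 4132, and two ways of extending them\<close>

definition avoids_213_4132 :: "nat list \<Rightarrow> bool" where
  "avoids_213_4132 xs \<longleftrightarrow> (\<forall>a b c. subseq [b, a, c] xs \<longrightarrow> \<not> (a < b \<and> b < c)) \<and>
     (\<forall>a b c d. subseq [d, a, c, b] xs \<longrightarrow> \<not> (a < b \<and> b < c \<and> c < d))"

lemma avoids_213_4132D:
  assumes "avoids_213_4132 xs"
  shows "subseq [b, a, c] xs \<Longrightarrow> a < b \<Longrightarrow> b < c \<Longrightarrow> False"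
    and "subseq [d, a, c, b] xs \<Longrightarrow> a < b \<Longrightarrow> b < c \<Longrightarrow> c < d \<Longrightarrow> False"
  using assms unfolding avoids_213_4132_def by blast+

lemma avoids_213_4132_subseq: "avoids_213_4132 ys \<Longrightarrow> subseq xs ys \<Longrightarrow> avoids_213_4132 xs"
  unfolding avoids_213_4132_def by (meson subseq_order.trans)

lemma subseq_set: "subseq xs ys \<Longrightarrow> set xs \<subseteq> set ys"
  by (metis notin_set_nthsI subseq_conv_nths subsetI)

text \<open>Both patterns begin with a descent, so no occurrence can start at a new minimum placed
  in front.\<close>

lemma avoids_213_4132_Cons_less:
  assumes "avoids_213_4132 xs" "\<And>x. x \<in> set xs \<Longrightarrow> l < x"
  shows "avoids_213_4132 (l # xs)"
proof -
  have *: "z = l \<and> l < y \<and> subseq (y # zs) xs \<or> subseq (z # y # zs) xs"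
    if "subseq (z # y # zs) (l # xs)" for z y zs
    using that assms(2) subseq_set[of "y # zs" xs] by (auto split: if_splits)
  show ?thesis
    unfolding avoids_213_4132_def
  proof (intro conjI allI impI notI)
    fix a b c assume "subseq [b, a, c] (l # xs)" "a < b \<and> b < c"
    then show False using *[of b a "[c]"] avoids_213_4132D(1)[OF assms(1)] by (metis less_asym)
  next
    fix a b c d assume "subseq [d, a, c, b] (l # xs)" "a < b \<and> b < c \<and> c < d"
    then show False using *[of d a "[c, b]"] avoids_213_4132D(2)[OF assms(1)] by (metis less_asym less_trans)
  qed
qed

text \<open>An occurrence splits into a part in \<open>xs\<close> and an increasing part below it in
  \<open>ys\<close>. A 213 cannot straddle the cut, since it ends with its maximum, nor lie in
  \<open>ys\<close>, since it begins with a descent. Of a 4132 at most the final 2 could lie in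
  \<open>ys\<close>, because 32 descends, but 2 is not below 1.\<close>

lemma avoids_213_4132_append_sorted:
  assumes "avoids_213_4132 xs" "sorted ys" "\<And>x y. x \<in> set xs \<Longrightarrow> y \<in> set ys \<Longrightarrow> y < x"
  shows "avoids_213_4132 (xs @ ys)"
proof -
  have split: "\<exists>us vs. zs = us @ vs \<and> subseq us xs \<and> sorted vs \<and>
      (\<forall>u\<in>set us. \<forall>v\<in>set vs. v < u)" if zs: "subseq zs (xs @ ys)" for zs
  proof -
    obtain us vs where uv: "zs = us @ vs" "subseq us xs" "subseq vs ys"
      using zs by (rule subseq_appendE)
    obtain N where "vs = nths ys N" using uv(3) unfolding subseq_conv_nths ..
    then have "sorted vs" using assms(2) by (simp only: sorted_nths)
    moreover have "\<forall>u\<in>set us. \<forall>v\<in>set vs. v < u"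
      using uv(2,3)[THEN subseq_set] assms(3) by (meson subsetD)
    ultimately show ?thesis using uv(1,2) by (intro exI conjI)
  qed
  show ?thesis
    unfolding avoids_213_4132_def
  proof (intro conjI allI impI notI)
    fix a b c assume *: "subseq [b, a, c] (xs @ ys)" "a < b \<and> b < c"
    obtain us vs where "[b, a, c] = us @ vs" "subseq us xs" "sorted vs" 
      "\<forall>u\<in>set us. \<forall>v\<in>set vs. v < u"
      using split[OF *(1)] by blast
    with *(2) show False
      using avoids_213_4132D(1)[OF assms(1), of b a c] by (auto simp: Cons_eq_append_conv)
  next
    fix a b c d assume *: "subseq [d, a, c, b] (xs @ ys)" "a < b \<and> b < c \<and> c < d"
    obtain us vs where "[d, a, c, b] = us @ vs" "subseq us xs" "sorted vs" 
      "\<forall>u\<in>set us. \<forall>v\<in>set vs. v < u"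
      using split[OF *(1)] by blast
    with *(2) show False
      using avoids_213_4132D(2)[OF assms(1), of d a c b] by (auto simp: Cons_eq_append_conv)
  qed
qed

section \<open>Encoding such words by lists of naturals\<close>

definition weight :: "nat list \<Rightarrow> nat" where
  "weight w = (\<Sum>x\<leftarrow>w. max 1 x)"

lemma weight_simps [simp]:
  "weight [] = 0" "weight (0 # w) = Suc (weight w)" "weight (Suc k # w) = Suc (k + weight w)"
  by (simp_all add: weight_def)

text \<open>The parameter \<open>l\<close> is the least entry of the result, so the recursive calls
  produce the actual values without relabelling. The empty list already stands for one entry, hence
  the length is \<open>weight w\<close> plus one; the letter 0 also contributes one entry, whence
  \<open>max 1\<close> in \<open>weight\<close>.\<close>

fun word_perm :: "nat \<Rightarrow> nat list \<Rightarrow> nat list" where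
  "word_perm l [] = [l]"
| "word_perm l (0 # w) = l # word_perm (Suc l) w"
| "word_perm l (Suc k # w) = word_perm (l + Suc k) w @ [l..<l + Suc k]"

lemma set_word_perm: "set (word_perm l w) = {l..l + weight w}"
proof (induction l w rule: word_perm.induct)
  case (3 l k w)
  have "set (word_perm l (Suc k # w)) = {l + Suc k..l + Suc k + weight w} \<union> {l..<l + Suc k}"
    unfolding word_perm.simps set_append set_upt "3.IH" ..
  also have "\<dots> = {l..l + weight (Suc k # w)}"
    unfolding weight_simps by (rule set_eqI) (simp, linarith)
  finally show ?case .
qed auto

lemma distinct_word_perm: "distinct (word_perm l w)"
proof (induction l w rule: word_perm.induct)
  case (3 l k w)
  then show ?case unfolding word_perm.simps distinct_append set_word_perm set_upt by auto
qed (simp_all add: set_word_perm)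

lemma length_word_perm: "length (word_perm l w) = Suc (weight w)"
  by (induction l w rule: word_perm.induct) (simp_all del: upt_Suc)

lemma avoids_213_4132_word_perm: "avoids_213_4132 (word_perm l w)"
proof (induction l w rule: word_perm.induct)
  case (1 l)
  then show ?case by (simp add: avoids_213_4132_def)
next
  case (2 l w)
  then show ?case using avoids_213_4132_Cons_less[of "word_perm (Suc l) w" l] by (simp add: set_word_perm)
next
  case (3 l k w)
  then show ?case
    using avoids_213_4132_append_sorted[of "word_perm (l + Suc k) w" "[l..<l + Suc k]"]
    by (simp add: set_word_perm del: upt_Suc)
qed

text \<open>The appended run carries the minimum, and the nonempty word before it lies above. Thus
  the first entry tells a letter 0 from a positive letter.\<close>

lemma hd_word_perm_Suc: "l < hd (word_perm l (Suc k # w))"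
proof -
  have "word_perm (l + Suc k) w \<noteq> []" using length_word_perm[of "l + Suc k" w] by auto
  then have "hd (word_perm l (Suc k # w)) \<in> set (word_perm (l + Suc k) w)" by simp
  then show ?thesis by (simp add: set_word_perm)
qed

text \<open>The first letter can be read off: a word of length one comes from the empty list, a
  longer one starting with \<open>l\<close> from a letter 0, and otherwise the last entry determines
  the letter.\<close>

lemma word_perm_inject: "word_perm l w = word_perm l w' \<Longrightarrow> w = w'"
proof (induction l w arbitrary: w' rule: word_perm.induct)
  case (1 l)
  then have "length (word_perm l w') = 1" by (metis word_perm.simps(1) length_Cons list.size(3) One_nat_def)
  then have "weight w' = 0" by (simp add: length_word_perm)
  then show ?case by (cases "(l, w')" rule: word_perm.cases) simp_all
next
  case (2 l w)
  from "2.prems" length_word_perm[of "Suc l" w] hd_word_perm_Suc[of l] show ?case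
    by (cases "(l, w')" rule: word_perm.cases) (auto intro: "2.IH" simp del: word_perm.simps(3), metis list.sel(1) less_irrefl)
next
  case (3 l k w)
  show ?case
  proof (cases "(l, w')" rule: word_perm.cases)
    case (1 l')
    then show ?thesis using "3.prems" arg_cong[OF "3.prems", of length] by (simp add: length_word_perm)
  next
    case (2 l' w'')
    then show ?thesis using "3.prems" hd_word_perm_Suc[of l k w] by simp
  next
    case (3 l' k' w'')
    then have w': "w' = Suc k' # w''" by simp
    have eq: "word_perm (l + Suc k) w @ [l..<l + Suc k] = word_perm (l + Suc k') w'' @ [l..<l + Suc k']"
      using "3.prems" unfolding w' word_perm.simps .
    \<comment> \<open>The run \<open>[l..<l + Suc k]\<close> ends in \<open>l + k\<close>.\<close>
    have kk: "k = k'" using arg_cong[OF eq, of last] by simp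
    have "word_perm (l + Suc k) w = word_perm (l + Suc k) w''" using eq unfolding kk by (rule append_same_eq[THEN iffD1])
    then have "w = w''" by (rule "3.IH")
    then show ?thesis using w' kk by simp
  qed
qed

section \<open>Decomposing an avoiding word at its minimum\<close>

lemma sorted_if_subseq_le:
  "(\<And>x y. subseq [x, y] xs \<Longrightarrow> x \<le> y) \<Longrightarrow> sorted xs" for xs :: "'a::linorder list"
proof (induction xs)
  case (Cons a xs)
  have "a \<le> y" if "y \<in> set xs" for y
    using Cons.prems[of a y] that by (simp add: subseq_singleton_left)
  moreover have "sorted xs" using Cons by blast
  ultimately show ?case by simp
qed simp

text \<open>Surjectivity of the encoding. The induction goes through because the shorter word left
  after removing the minimum or the final run again fills an interval of values.\<close>

lemma avoids_213_4132_imp_word_perm: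
  assumes "distinct xs" "avoids_213_4132 xs" "set xs = {l..<u}" "l < u"
  shows "\<exists>w. xs = word_perm l w"
  using assms
proof (induction "length xs" arbitrary: xs l rule: less_induct)
  case less
  obtain A B where AB: "xs = A @ l # B"
    using less.prems by (metis atLeastLessThan_iff order_refl split_list)
  have ne: "l \<notin> set A" "l \<notin> set B" "set A \<inter> set B = {}" "distinct A" "distinct B"
    using less.prems(1) AB by auto
  have un: "set A \<union> set B = {Suc l..<u}"
  proof -
    have "set A \<union> set B = set xs - {l}" using ne(1,2) unfolding AB by auto
    also have "\<dots> = {Suc l..<u}" unfolding less.prems(3) by auto
    finally show ?thesis .
  qed
  show ?case
  proof (cases "A = []")
    case True
    note A = True
    show ?thesis
    proof (cases "B = []")
      case True
      then have "xs = word_perm l []" using AB A by simp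
      then show ?thesis ..
    next
      case False
      have "avoids_213_4132 B" using less.prems(2) by (rule avoids_213_4132_subseq) (auto simp: AB A)
      moreover have "set B = {Suc l..<u}" using un A by simp
      moreover have "{Suc l..<u} \<noteq> {}" unfolding un[symmetric] using False by simp
      ultimately obtain w where "B = word_perm (Suc l) w"
        using less.hyps[of B "Suc l"] AB ne(5) by auto
      then have "xs = word_perm l (0 # w)" using AB A by simp
      then show ?thesis ..
    qed
  next
    case False
    \<comment> \<open>The threshold between the values: \<open>B\<close> will turn out to fill
      \<open>{Suc l..<t}\<close> and \<open>A\<close> to fill \<open>{t..<u}\<close>.\<close>
    define t where "t = Min (set A)"
    have tA: "t \<in> set A" "\<And>x. x \<in> set A \<Longrightarrow> t \<le> x" using False by (auto simp: t_def)
    have tU: "t \<in> {Suc l..<u}" using un tA(1) by blast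
    have less_l: "l < x" if "x \<in> set A \<union> set B" for x using that un by auto
    have BA: "b < a" if "a \<in> set A" "b \<in> set B" for a b
    proof (rule ccontr)
      assume "\<not> b < a"
      then have "a < b" using that ne by (metis disjoint_iff linorder_neqE_nat)
      \<comment> \<open>With \<open>a < b\<close> the entries \<open>a\<close>, \<open>l\<close>,
        \<open>b\<close> form a 213.\<close>
      have "subseq ([a] @ [l, b]) (A @ l # B)"
        using that by (intro list_emb_append_mono) (auto simp: subseq_singleton_left)
      then show False
        using avoids_213_4132D(1)[OF less.prems(2), of a l b] less_l[of a] that \<open>a < b\<close> by (simp add: AB)
    qed
    have "sorted B"
    proof (rule sorted_if_subseq_le, rule ccontr)
      fix x y assume xy: "subseq [x, y] B" "\<not> x \<le> y"
      \<comment> \<open>A descent \<open>x\<close>, \<open>y\<close> in \<open>B\<close> completes a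
        4132 with \<open>t\<close>, which is above all of \<open>B\<close>, and
        \<open>l\<close>.\<close>
      have "subseq ([t] @ [l, x, y]) (A @ l # B)"
        using tA xy(1) by (intro list_emb_append_mono) (simp_all add: subseq_singleton_left)
      moreover have "x \<in> set B" "y \<in> set B" using subseq_set[OF xy(1)] by auto
      ultimately show False
        using avoids_213_4132D(2)[OF less.prems(2), of t l x y] less_l[of y] BA[of t x] tA xy(2)
        by (simp add: AB)
    qed
    have sB: "set B = {Suc l..<t}" and sA: "set A = {t..<u}"
    proof -
      have tu: "t < u" "l < t" using tU by auto
      show "set B = {Suc l..<t}"
      proof (intro equalityI subsetI)
        fix x assume "x \<in> {Suc l..<t}"
        then have "x \<in> set A \<union> set B" "x \<notin> set A" using un tu tA(2)[of x] by auto
        then show "x \<in> set B" by blast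
      next
        fix x assume "x \<in> set B"
        then show "x \<in> {Suc l..<t}" using less_l[of x] BA[OF tA(1), of x] by auto
      qed
      show "set A = {t..<u}"
      proof (intro equalityI subsetI)
        fix x assume "x \<in> {t..<u}"
        then have "x \<in> set A \<union> set B" "x \<notin> set B" using un tu BA[OF tA(1), of x] by auto
        then show "x \<in> set A" by blast
      next
        fix x assume "x \<in> set A"
        then show "x \<in> {t..<u}" using un tA(2) by (metis UnI1 atLeastLessThan_iff)
      qed
    qed
    have "B = [Suc l..<t]"
      using \<open>sorted B\<close> ne(5) sB by (intro sorted_distinct_set_unique) auto
    moreover have lt: "l < t" using tU by simp
    ultimately have tail: "l # B = [l..<t]" by (simp add: upt_conv_Cons)
    have "avoids_213_4132 A" using less.prems(2) by (rule avoids_213_4132_subseq) (simp add: AB subseq_rev_drop_many)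
    then obtain w where "A = word_perm t w"
      using less.hyps[of A t] AB ne(4) sA tA(1) by auto
    \<comment> \<open>The recorded letter is the run length \<open>t - l\<close>, written as a
      successor to match the third equation.\<close>
    then have "xs = word_perm l (Suc (t - Suc l) # w)" using AB tail lt by (simp del: upt_Suc)
    then show ?thesis ..
  qed
qed


section \<open>From circular avoidance of 1324 to avoidance by the word after the minimum\<close>

lemma subseq_rotate:
  assumes "subseq xs (rotate k ys)"
  shows "\<exists>j. subseq (rotate j xs) ys"
proof -
  define m where "m = k mod length ys"
  have "subseq xs (drop m ys @ take m ys)" using assms by (simp add: rotate_drop_take m_def)
  then obtain us vs where uv: "xs = us @ vs" "subseq us (drop m ys)" "subseq vs (take m ys)"
    by (rule subseq_appendE)
  \<comment> \<open>Undoing the rotation of \<open>ys\<close> swaps the two pieces of the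
    occurrence, which is itself a rotation of \<open>xs\<close>.\<close>
  have "subseq (vs @ us) (take m ys @ drop m ys)"
    using uv(3,2) by (rule list_emb_append_mono)
  then have "subseq (rotate (length us) xs) ys" by (simp add: uv(1) rotate_append)
  then show ?thesis ..
qed

text \<open>An occurrence whose first letter is not its least cannot use the leading minimum
  \<open>l\<close>.\<close>

lemma subseq_Cons_lower_bound:
  fixes l :: "'a::order"
  assumes "subseq (x # zs) (l # ys)" "\<And>y. y \<in> set ys \<Longrightarrow> l < y" "y \<in> set zs" "y < x"
  shows "subseq (x # zs) ys"
proof (cases "x = l")
  case True
  then have "subseq zs ys" using assms(1) by simp
  then have "l < y" using assms(2,3) subseq_set by blast
  then show ?thesis using True assms(4) by (auto dest: less_asym)
qed (use assms(1) in simp)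

lemma order_isomorphic_1324:
  "order_isomorphic xs [1, 3, 2, 4] \<longleftrightarrow> (\<exists>a b c d. xs = [a, c, b, d] \<and> a < b \<and> b < c \<and> c < d)"
proof
  assume *: "order_isomorphic xs [1, 3, 2, 4]"
  then have "length xs = Suc (Suc (Suc (Suc 0)))" by (simp add: order_isomorphic_def)
  then obtain a c b d where xs: "xs = [a, c, b, d]" by (auto simp: length_Suc_conv)
  have "xs ! i < xs ! j \<longleftrightarrow> [1, 3, 2, 4::nat] ! i < [1, 3, 2, 4] ! j" if "i < 4" "j < 4" for i j
    using * that by (simp add: order_isomorphic_def)
  \<comment> \<open>These index pairs compare 1 with 2, 2 with 3 and 3 with 4.\<close>
  from this[of 0 2] this[of 2 1] this[of 1 3]
  show "\<exists>a b c d. xs = [a, c, b, d] \<and> a < b \<and> b < c \<and> c < d" by (simp add: xs)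
qed (auto simp: order_isomorphic_def less_Suc_eq)

text \<open>The rotations of 1324 are 1324, 3241, 2413 and 4132. The first leaves 324, a copy of
  213, once its 1 is dropped; the next two contain 324 and 213; the last is the second forbidden
  pattern. Conversely, \<open>l\<close> in front of a 213 gives 1324, and 4132 is a rotation of
  1324.\<close>

lemma circ_contains_1324_iff:
  assumes l: "\<And>x. x \<in> set xs \<Longrightarrow> l < x"
  shows "circ_contains (circ (l # xs)) [1, 3, 2, 4] \<longleftrightarrow> \<not> avoids_213_4132 xs"
proof
  assume "circ_contains (circ (l # xs)) [1, 3, 2, 4]"
  then obtain k a b c d where abcd: "a < b" "b < c" "c < d"
    and "subseq [a, c, b, d] (rotate k (l # xs))"
    unfolding circ_contains_def circ_def has_pattern_def order_isomorphic_1324 by auto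
  then obtain j where "subseq (rotate j [a, c, b, d]) (l # xs)"
    using subseq_rotate by blast
  then have "subseq (rotate (j mod 4) [a, c, b, d]) (l # xs)"
    by (subst (asm) rotate_conv_mod) simp
  then obtain r where r: "r < 4" "subseq (rotate r [a, c, b, d]) (l # xs)"
    by (metis mod_less_divisor zero_less_numeral)
  note lower = subseq_Cons_lower_bound[where l = l and ys = xs, OF _ l]
  from r(1) consider "r = 0" | "r = 1" | "r = 2" | "r = 3" by linarith
  then have "subseq [c, b, d] xs \<or> subseq [b, a, c] xs \<or> subseq [d, a, c, b] xs"
  proof cases
    case 1
    then show ?thesis using r(2) by (auto split: if_splits dest: subseq_Cons')
  next
    case 2
    then have "subseq [c, b, d, a] (l # xs)" using r(2) by simp
    then have "subseq ([c, b, d] @ [a]) xs" using lower[where x = c and zs = "[b, d, a]" and y = b] abcd by simp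
    then show ?thesis by (metis list_emb_append2 prefixI prefix_imp_subseq subseq_order.trans)
  next
    case 3
    then have "subseq [b, d, a, c] (l # xs)" using r(2) by (simp add: eval_nat_numeral)
    then have "subseq [b, d, a, c] xs" using lower[where x = b and zs = "[d, a, c]" and y = a] abcd by simp
    moreover have "subseq [b, a, c] [b, d, a, c]" by auto
    ultimately show ?thesis by (meson subseq_order.trans)
  next
    case 4
    then have "subseq [d, a, c, b] (l # xs)" using r(2) by (simp add: eval_nat_numeral)
    then have "subseq [d, a, c, b] xs" by (rule lower[where y = a]) (use abcd in auto)
    then show ?thesis by blast
  qed
  then show "\<not> avoids_213_4132 xs" using avoids_213_4132D abcd by metis
next
  assume "\<not> avoids_213_4132 xs"
  then consider a b c where "subseq [b, a, c] xs" "a < b" "b < c"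
    | a b c d where "subseq [d, a, c, b] xs" "a < b" "b < c" "c < d"
    unfolding avoids_213_4132_def by blast
  then show "circ_contains (circ (l # xs)) [1, 3, 2, 4]"
  proof cases
    case 1
    then have "a \<in> set xs" using subseq_set by fastforce
    then have "order_isomorphic [l, b, a, c] [1, 3, 2, 4]"
      unfolding order_isomorphic_1324 using l 1(2,3) by blast
    moreover have "subseq [l, b, a, c] (rotate 0 (l # xs))" using 1 by simp
    ultimately show ?thesis
      unfolding circ_contains_def circ_def has_pattern_def by blast
  next
    case 2
    have "order_isomorphic [d, a, c, b] [4, 1, 3, 2]"
      using 2 by (auto simp: order_isomorphic_def less_Suc_eq)
    moreover have "subseq [d, a, c, b] (rotate 0 (l # xs))"
      using 2(1) list_emb_Cons[of _ "[d, a, c, b]" xs l] by (simp only: rotate0 id_apply)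
    ultimately have "circ_contains (circ (l # xs)) [4, 1, 3, 2]"
      unfolding circ_contains_def circ_def has_pattern_def by blast
    then have "circ_contains (circ (l # xs)) (rotate 1 [4, 1, 3, 2])"
      by (simp only: circ_contains_rotate)
    then show ?thesis by simp
  qed
qed

section \<open>Representing a circular permutation by the rotation starting with 1\<close>

lemma circ_rotate: "circ (rotate k xs) = circ xs"
proof (cases "xs = []")
  case False
  \<comment> \<open>The inverse of rotating by \<open>k\<close>: together the two rotations make
    \<open>k\<close> full turns.\<close>
  then have "k * (length xs - 1) + k = k * length xs" by (cases xs) auto
  then have "rotate (k * (length xs - 1)) (rotate k xs) = xs"
    by (simp add: rotate_rotate rotate_id)
  then have "xs \<in> circ (rotate k xs)" unfolding circ_def by (metis (mono_tags, lifting) mem_Collect_eq)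
  then have "rotate j xs \<in> circ (rotate k xs)" for j by (rule circ_rotate_closed)
  moreover have "rotate j (rotate k xs) \<in> circ xs" for j by (auto simp: circ_def rotate_rotate)
  ultimately show ?thesis by (auto simp: circ_def[of xs] circ_def[of "rotate k xs"])
qed (simp add: circ_def)

text \<open>As the entries are distinct, a rotation that keeps \<open>x\<close> in front is
  trivial.\<close>

lemma circ_Cons_inject:
  assumes "circ (x # ys) = circ (x # zs)" "distinct (x # ys)"
  shows "ys = zs"
proof -
  have "rotate 0 (x # zs) \<in> circ (x # zs)" unfolding circ_def by blast
  then obtain k where k: "x # zs = rotate k (x # ys)"
    using assms(1) by (auto simp: circ_def)
  then have "(x # ys) ! (k mod length (x # ys)) = (x # ys) ! 0"
    using hd_rotate_conv_nth[of "x # ys" k] by (metis list.distinct(1) list.sel(1) nth_Cons_0)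
  then have "k mod length (x # ys) = 0"
    using assms(2) by (subst (asm) nth_eq_iff_index_eq) auto
  then show ?thesis using k rotate_id by auto
qed

text \<open>The offset 2 counts the leading 1 and the single entry produced by the empty
  list.\<close>

lemma bij_betw_circ_Av:
  "bij_betw (\<lambda>w. circ (1 # word_perm 2 w)) {w. weight w = m} (circ_Av (m + 2) [1, 3, 2, 4])"
  unfolding bij_betw_def
proof (intro conjI inj_onI equalityI subsetI)
  fix w w' assume "circ (1 # word_perm 2 w) = circ (1 # word_perm 2 w')"
  then show "w = w'"
    by (intro word_perm_inject[of 2 w w'] circ_Cons_inject) (auto simp: distinct_word_perm set_word_perm)
next
  fix S assume "S \<in> (\<lambda>w. circ (1 # word_perm 2 w)) ` {w. weight w = m}"
  then obtain w where w: "weight w = m" "S = circ (1 # word_perm 2 w)" by auto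
  have "\<not> circ_contains S [1, 3, 2, 4]"
    unfolding w(2) by (subst circ_contains_1324_iff) (auto simp: set_word_perm avoids_213_4132_word_perm)
  moreover have "1 # word_perm 2 w \<in> permutations_of_set {1..m + 2}"
    using w(1) by (auto intro!: permutations_of_setI simp: set_word_perm distinct_word_perm)
  ultimately show "S \<in> circ_Av (m + 2) [1, 3, 2, 4]"
    unfolding circ_Av_def circular_permutations_def w(2) by blast
next
  fix S assume S: "S \<in> circ_Av (m + 2) [1, 3, 2, 4]"
  then obtain p where p: "set p = {1..m + 2}" "distinct p" "S = circ p"
    unfolding circ_Av_def circular_permutations_def by (auto dest: permutations_of_setD)
  then obtain u v where uv: "p = u @ 1 # v"
    by (metis atLeastAtMost_iff le_add2 one_le_numeral order_refl order_trans split_list)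
  define xs where "xs = v @ u"
  have "S = circ (1 # xs)"
    using circ_rotate[of "length u" p] rotate_append[of u "1 # v"] by (simp add: p(3) uv xs_def)
  moreover have xs: "distinct xs" "set xs = {2..<m + 3}"
  proof -
    show "distinct xs" using p(2) unfolding uv xs_def by auto
    have "set xs = set p - {1}" using p(2) unfolding uv xs_def by auto
    also have "\<dots> = {2..<m + 3}" unfolding p(1) by (rule set_eqI) (simp, linarith)
    finally show "set xs = {2..<m + 3}" .
  qed
  moreover have "avoids_213_4132 xs"
    using S circ_contains_1324_iff[of xs 1] xs(2) by (auto simp: circ_Av_def calculation(1))
  ultimately obtain w where w: "xs = word_perm 2 w" using avoids_213_4132_imp_word_perm[of xs 2 "m + 3"] by auto
  moreover have "weight w = m"
    using distinct_card[OF xs(1)] by (simp add: xs(2)) (simp add: w length_word_perm)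
  ultimately show "S \<in> (\<lambda>w. circ (1 # word_perm 2 w)) ` {w. weight w = m}"
    using \<open>S = circ (1 # xs)\<close> by blast
qed

section \<open>Circled compositions as lists of naturals with 0 at both ends\<close>

definition circled :: "nat list \<Rightarrow> nat list \<times> nat set" where
  "circled v = (map (max 1) v, {i \<in> {1..length v}. v ! (i - 1) = 0})"

definition uncircled :: "nat list \<times> nat set \<Rightarrow> nat list" where
  "uncircled = (\<lambda>(a, C). map (\<lambda>i. if Suc i \<in> C then 0 else a ! i) [0..<length a])"

text \<open>Replacing 0 by 1 loses nothing, since the circles remember where the zeros were; circles
  on the first and last part mean zeros at both ends.\<close>

lemma bij_betw_circled:
  "bij_betw circled {v. v \<noteq> [] \<and> hd v = 0 \<and> last v = 0 \<and> weight v = n} (circled_compositions n)"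
proof (rule bij_betw_byWitness[where f' = uncircled])
  show "\<forall>v\<in>{v. v \<noteq> [] \<and> hd v = 0 \<and> last v = 0 \<and> weight v = n}. uncircled (circled v) = v"
    by (auto simp: circled_def uncircled_def intro!: nth_equalityI)
  have right: "circled (uncircled (a, C)) = (a, C)" if "(a, C) \<in> circled_compositions n" for a C
  proof -
    have a: "\<forall>x\<in>set a. 0 < x" "C \<subseteq> {1..length a}" "\<forall>i\<in>C. a ! (i - 1) = 1"
      using that by (auto simp: circled_compositions_def)
    have "map (max 1) (uncircled (a, C)) = a"
    proof (rule nth_equalityI)
      fix i assume "i < length (map (max 1) (uncircled (a, C)))"
      then have i: "i < length a" by (simp add: uncircled_def)
      then have "0 < a ! i" using a(1) by simp
      \<comment> \<open>At a circled position the 0 becomes 1, which is the value a circled part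
        must have; elsewhere positivity makes \<open>max 1\<close> harmless.\<close>
      then show "map (max 1) (uncircled (a, C)) ! i = a ! i"
        using i a(3) by (fastforce simp: uncircled_def)
    qed (simp add: uncircled_def)
    moreover have "{i \<in> {1..length a}. uncircled (a, C) ! (i - 1) = 0} = C"
    proof (intro equalityI subsetI)
      fix i assume "i \<in> {i \<in> {1..length a}. uncircled (a, C) ! (i - 1) = 0}"
      then have i: "1 \<le> i" "i - 1 < length a" "uncircled (a, C) ! (i - 1) = 0" by auto
      then have "0 < a ! (i - 1)" using a(1) by simp
      then show "i \<in> C" using i by (auto simp: uncircled_def split: if_splits)
    next
      fix i assume "i \<in> C"
      moreover from this have "1 \<le> i" "i \<le> length a" using a(2) by auto
      ultimately show "i \<in> {i \<in> {1..length a}. uncircled (a, C) ! (i - 1) = 0}"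
        by (auto simp: uncircled_def)
    qed
    ultimately show ?thesis by (simp add: circled_def uncircled_def)
  qed
  then show "\<forall>x\<in>circled_compositions n. circled (uncircled x) = x" by auto
  show "circled ` {v. v \<noteq> [] \<and> hd v = 0 \<and> last v = 0 \<and> weight v = n} \<subseteq> circled_compositions n"
    by (auto simp: circled_def circled_compositions_def weight_def hd_conv_nth last_conv_nth Suc_le_eq)
  show "uncircled ` circled_compositions n
      \<subseteq> {v. v \<noteq> [] \<and> hd v = 0 \<and> last v = 0 \<and> weight v = n}"
  proof clarify
    fix a C assume aC: "(a, C) \<in> circled_compositions n"
    then have "1 \<in> C" "length a \<in> C" "C \<subseteq> {1..length a}" "sum_list a = n"
      by (auto simp: circled_compositions_def)
    moreover from this have "a \<noteq> []" by auto
    moreover have "map (max 1) (uncircled (a, C)) = a"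
      using right[OF aC] by (simp add: circled_def)
    ultimately show "uncircled (a, C) \<noteq> [] \<and> hd (uncircled (a, C)) = 0 \<and>
        last (uncircled (a, C)) = 0 \<and> weight (uncircled (a, C)) = n"
      by (simp add: weight_def) (simp add: uncircled_def hd_conv_nth last_conv_nth)
  qed
qed

text \<open>Each end zero weighs one, and weight at least 2 forces the two ends to be different
  positions.\<close>

lemma bij_betw_bracket:
  "bij_betw (\<lambda>w. 0 # w @ [0]) {w. weight w = m}
     {v. v \<noteq> [] \<and> hd v = 0 \<and> last v = 0 \<and> weight v = m + 2}"
  unfolding bij_betw_def
proof (intro conjI inj_onI equalityI subsetI)
  fix v assume v: "v \<in> {v. v \<noteq> [] \<and> hd v = 0 \<and> last v = 0 \<and> weight v = m + 2}"
  then obtain u where u: "v = 0 # u" by (cases v) auto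
  with v have "u \<noteq> []" by auto
  then obtain w where "v = 0 # w @ [0]" using u v by (cases u rule: rev_cases) auto
  with v show "v \<in> (\<lambda>w. 0 # w @ [0]) ` {w. weight w = m}" by (auto simp: weight_def)
qed (auto simp: weight_def)

section \<open>Size one, and the final count\<close>

lemma card_circ_Av_one: "card (circ_Av 1 [1, 3, 2, 4]) = 1"
proof -
  have "avoids_213_4132 []" by (simp add: avoids_213_4132_def)
  then have "\<not> circ_contains (circ [1]) [1, 3, 2, 4]" by (subst circ_contains_1324_iff) auto
  then have "circ_Av 1 [1, 3, 2, 4] = {circ [1]}"
    by (auto simp: circ_Av_def circular_permutations_def)
  then show ?thesis by simp
qed

text \<open>The leading zero exhausts the weight, so \<open>[0]\<close> is the only list, its first
  and last positions being the same.\<close>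

lemma card_circled_compositions_one: "card (circled_compositions 1) = 1"
proof -
  have "v = [0]" if "v \<noteq> []" "hd v = 0" "weight v = 1" for v
  proof -
    obtain u where "v = 0 # u" using \<open>v \<noteq> []\<close> \<open>hd v = 0\<close> by (cases v) auto
    moreover from this have "weight u = 0" using \<open>weight v = 1\<close> by simp
    then have "u = []" by (cases u) (auto simp: weight_def)
    ultimately show ?thesis by simp
  qed
  then have "{v. v \<noteq> [] \<and> hd v = 0 \<and> last v = 0 \<and> weight v = 1} = {[0]}" by auto
  then show ?thesis using bij_betw_same_card[OF bij_betw_circled[of 1]] by simp
qed

theorem theorem4p8:
  fixes n :: nat
  assumes "n \<ge> 1"
  shows "(\<exists>f. bij_betw f (circ_Av n [1, 3, 2, 4]) (circled_compositions n)) \<and>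
         card (circ_Av n [1, 3, 2, 4]) = card (circled_compositions n)"
proof -
  have "card (circ_Av n [1, 3, 2, 4]) = card (circled_compositions n)"
  proof (cases "n = 1")
    case True
    then show ?thesis by (simp only: card_circ_Av_one card_circled_compositions_one)
  next
    case False
    then obtain m where "n = m + 2" using assms by (metis add.commute le_Suc_ex le_neq_implies_less Suc_1 Suc_leI)
    \<comment> \<open>Both cardinalities equal the number of lists of weight
      \<open>m\<close>.\<close>
    then show ?thesis
      using bij_betw_same_card[OF bij_betw_circ_Av[of m]] bij_betw_same_card[OF bij_betw_bracket[of m]]
        bij_betw_same_card[OF bij_betw_circled[of n]] by simp
  qed
  \<comment> \<open>Equal cardinality of finite sets yields the bijection, uniformly for size one
    and larger sizes.\<close>
  then show ?thesis
    using finite_same_card_bij[OF finite_circ_Av finite_circled_compositions] by blast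
qed

end
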